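(* Let $\|\cdot\|$ be a norm on $\mathbb{R}^d$ (the source norm), with associated Capra coupling $c$. Suppose that both the norm $\|\cdot\|$ and its dual norm $\|\cdot\|_\star$ are orthant-strictly monotonic. Then, for any nondecreasing finite-valued set function $F : 2^V \to \mathbb{R}$, we have $$ (F\circ \mathrm{supp})^{c c'} = F\circ\mathrm{supp}, $$ that is, the function $F\circ\mathrm{supp} : \mathbb{R}^d\to\mathbb{R}$ is $c$-convex (Capra-convex).
   Context: $d\ge 1$ is an integer, $V=\{1,\ldots,d\}$, $\langle\cdot,\cdot\rangle$ is the standard scalar product on $\mathbb{R}^d$, $\overline{\mathbb{R}}=[-\infty,+\infty]$. The support mapping is $\mathrm{supp}:\mathbb{R}^d\to 2^V$, $\mathrm{supp}(x)=\{j\in V: x_j\neq 0\}$. A set function $F$ is nondecreasing if $J\subset K\subset V$ implies $F(J)\le F(K)$. The dual norm is $\|y\|_\star=\sup_{\|x\|\le 1}\langle x,y\rangle$. A norm $N$ on $\mathbb{R}^d$ is orthant-strictly monotonic if for all $x,x'\in\mathbb{R}^d$: if $|x_i|\le|x'_i|$ for all $i$ with at least one strict inequality, and $x_ix'_i\ge 0$ for all $i$, then $N(x)<N(x')$. The Capra coupling $c:\mathbb{R}^d\times\mathbb{R}^d\to\mathbb{R}$ is $c(x,y)=\langle x,y\rangle/\|x\|$ if $x\ne 0$, and $c(0,y)=0$. Let $\dot{+}_{\mathrm{low}}$ denote the Moreau lower addition, extending $+$ to $\overline{\mathbb{R}}$ with $(+\infty)\dot{+}_{\mathrm{low}}(-\infty)=(-\infty)\dot{+}_{\mathrm{low}}(+\infty)=-\infty$.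 For $f:\mathbb{R}^d\to\overline{\mathbb{R}}$, the $c$-conjugate is $f^c(y)=\sup_{x\in\mathbb{R}^d}\big(c(x,y)\,\dot{+}_{\mathrm{low}}\,(-f(x))\big)$ and the $c$-biconjugate is $f^{cc'}(x)=\sup_{y\in\mathbb{R}^d}\big(c(x,y)\,\dot{+}_{\mathrm{low}}\,(-f^c(y))\big)$. The function $f$ is $c$-convex if $f^{cc'}=f$. *)

theory Defs
  imports "HOL-Analysis.Analysis"
begin

text \<open>
  The source norm is an arbitrary norm \<open>N\<close> on \<^typ>\<open>real ^ 'n\<close>, unrelated to the
  Euclidean norm of the type class; the finite index type \<open>'n\<close> plays the role of
  \<open>V = {1, \<dots>, d}\<close>, so \<open>d = CARD('n)\<close>.
\<close>

definition is_norm :: "('a::real_vector \<Rightarrow> real) \<Rightarrow> bool" where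
  "is_norm N \<longleftrightarrow>
     (\<forall>x. 0 \<le> N x) \<and>
     (\<forall>x. N x = 0 \<longleftrightarrow> x = 0) \<and>
     (\<forall>a x. N (a *\<^sub>R x) = \<bar>a\<bar> * N x) \<and>
     (\<forall>x y. N (x + y) \<le> N x + N y)"

text \<open>
  The supremum is taken in \<^typ>\<open>real\<close>; it is meaningful when \<open>N\<close> is a norm, because
  its unit ball is then nonempty and bounded in finite dimension.
\<close>

definition dual_norm :: "(real ^ 'n \<Rightarrow> real) \<Rightarrow> real ^ 'n \<Rightarrow> real" where
  "dual_norm N y = (SUP x\<in>{x. N x \<le> 1}. x \<bullet> y)"

definition orthant_strictly_monotonic :: "(real ^ 'n \<Rightarrow> real) \<Rightarrow> bool" where
  "orthant_strictly_monotonic N \<longleftrightarrow>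
     (\<forall>x x'. (\<forall>i. \<bar>x $ i\<bar> \<le> \<bar>x' $ i\<bar>) \<and> (\<exists>i. \<bar>x $ i\<bar> < \<bar>x' $ i\<bar>) \<and> (\<forall>i. x $ i * x' $ i \<ge> 0)
        \<longrightarrow> N x < N x')"

definition supp :: "real ^ 'n \<Rightarrow> 'n set" where
  "supp x = {j. x $ j \<noteq> 0}"

definition capra :: "(real ^ 'n \<Rightarrow> real) \<Rightarrow> real ^ 'n \<Rightarrow> real ^ 'n \<Rightarrow> real" where
  "capra N x y = (if x = 0 then 0 else (x \<bullet> y) / N x)"

text \<open>
  Moreau lower addition. The library's addition on \<^typ>\<open>ereal\<close> is the upper one:
  it yields \<open>\<infinity>\<close> on \<open>\<infinity> + (-\<infinity>)\<close>.
\<close>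

definition lower_add :: "ereal \<Rightarrow> ereal \<Rightarrow> ereal" where
  "lower_add a b = (if a = -\<infinity> \<or> b = -\<infinity> then -\<infinity> else a + b)"

definition conjugate :: "('a \<Rightarrow> 'b \<Rightarrow> real) \<Rightarrow> ('a \<Rightarrow> ereal) \<Rightarrow> 'b \<Rightarrow> ereal" where
  "conjugate c f y = (SUP x. lower_add (ereal (c x y)) (- f x))"

text \<open>The second conjugation is with respect to the reverse coupling \<open>c' y x = c x y\<close>.\<close>

definition biconjugate :: "('a \<Rightarrow> 'b \<Rightarrow> real) \<Rightarrow> ('a \<Rightarrow> ereal) \<Rightarrow> 'a \<Rightarrow> ereal" where
  "biconjugate c f = conjugate (\<lambda>y x. c x y) (conjugate c f)"

definition coupling_convex :: "('a \<Rightarrow> 'b \<Rightarrow> real) \<Rightarrow> ('a \<Rightarrow> ereal) \<Rightarrow> bool" where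
  "coupling_convex c f \<longleftrightarrow> biconjugate c f = f"

end

theory Submission
  imports Defs
begin

text \<open>
  The function \<open>f = F \<circ> supp\<close> is convex for the Capra coupling because it has a subgradient for
  this coupling at every point \<open>x\<close>: a vector \<open>y\<close> such that \<open>x\<close> maximises \<open>z \<mapsto> c z y - f z\<close>.
  The existence of a subgradient forces \<open>f\<close> to agree with its biconjugate at \<open>x\<close>
  (lemma \<open>biconjugate_eq_if_subgradient\<close>).

  The subgradient is \<open>t *\<^sub>R y\<close>, where \<open>y\<close> is dual to \<open>x\<close>, that is, attains equality in
  \<open>x \<bullet> y \<le> N x * dual_norm N y\<close>, and where \<open>t\<close> is large. Strict monotonicity of the two norms forces
  \<open>supp y = supp x\<close> (lemma \<open>ex_dual_vector_same_supp\<close>): deleting a coordinate of \<open>y\<close> outside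
  \<open>supp x\<close>, or a coordinate of \<open>x\<close> outside \<open>supp y\<close>, would leave \<open>x \<bullet> y\<close> unchanged but decrease the
  product of the norms. The value of the coupling at \<open>z\<close> and \<open>y\<close> is at most the dual norm of the
  restriction of \<open>y\<close> to \<open>supp z\<close>. If \<open>supp x \<subseteq> supp z\<close>, then this restriction is \<open>y\<close>, so that the
  coupling is no larger at \<open>z\<close> than at \<open>x\<close>, while \<open>F (supp x) \<le> F (supp z)\<close> by monotonicity.
  Otherwise the restriction has strictly smaller dual norm than \<open>y\<close>; the gap takes finitely many
  values, one for each support, so multiplying \<open>y\<close> by a large \<open>t\<close> makes it exceed the largest
  possible loss, \<open>F (supp x) - F {}\<close>.
\<close>

section \<open>Biconjugates and subgradients for a coupling\<close>

lemma biconjugate_le: "biconjugate c f x \<le> f x"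
  unfolding biconjugate_def conjugate_def[of "\<lambda>y x. c x y"]
proof (rule SUP_least)
  fix y
  have "lower_add (ereal (c x y)) (- f x) \<le> conjugate c f y"
    unfolding conjugate_def by (rule SUP_upper) simp
  then show "lower_add (ereal (c x y)) (- conjugate c f y) \<le> f x"
    by (cases "f x"; cases "conjugate c f y") (auto simp: lower_add_def split: if_splits)
qed

text \<open>
  Under this hypothesis the supremum that defines the conjugate at \<open>y\<close> is attained at \<open>x\<close>, so \<open>y\<close>
  contributes exactly \<open>f x\<close> to the biconjugate at \<open>x\<close>.
\<close>

lemma biconjugate_eq_if_subgradient:
  fixes f :: "'a \<Rightarrow> real"
  assumes "\<And>z. c z y - f z \<le> c x y - f x"
  shows "biconjugate c (\<lambda>x. ereal (f x)) x = ereal (f x)"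
proof (rule antisym[OF biconjugate_le])
  have "conjugate c (\<lambda>x. ereal (f x)) y \<le> ereal (c x y - f x)"
    unfolding conjugate_def
    by (rule SUP_least) (use assms in \<open>simp add: lower_add_def\<close>)
  then have "ereal (f x) \<le> lower_add (ereal (c x y)) (- conjugate c (\<lambda>x. ereal (f x)) y)"
    by (cases "conjugate c (\<lambda>x. ereal (f x)) y") (auto simp: lower_add_def)
  also have "\<dots> \<le> biconjugate c (\<lambda>x. ereal (f x)) x"
    unfolding biconjugate_def conjugate_def[of "\<lambda>y x. c x y"]
    by (rule SUP_upper) simp
  finally show "ereal (f x) \<le> biconjugate c (\<lambda>x. ereal (f x)) x" .
qed

section \<open>Norms and dual norms\<close>

lemma is_norm_pos: "is_norm N \<Longrightarrow> x \<noteq> 0 \<Longrightarrow> 0 < N x"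
  unfolding is_norm_def by (metis order_le_less)

lemma is_norm_scaleR: "is_norm N \<Longrightarrow> N (a *\<^sub>R x) = \<bar>a\<bar> * N x"
  unfolding is_norm_def by blast

lemma is_norm_zero: "is_norm N \<Longrightarrow> N 0 = 0"
  unfolding is_norm_def by blast

lemma is_norm_convex_on:
  assumes "is_norm N"
  shows "convex_on UNIV N"
proof (rule convex_onI)
  fix t :: real and x y
  assume t: "0 < t" "t < 1"
  have "N ((1 - t) *\<^sub>R x + t *\<^sub>R y) \<le> N ((1 - t) *\<^sub>R x) + N (t *\<^sub>R y)"
    using assms unfolding is_norm_def by blast
  also have "\<dots> = (1 - t) * N x + t * N y"
    using t by (simp add: is_norm_scaleR[OF assms])
  finally show "N ((1 - t) *\<^sub>R x + t *\<^sub>R y) \<le> (1 - t) * N x + t * N y" .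
qed simp

text \<open>
  A norm is convex, hence continuous, hence bounded away from zero on the compact Euclidean sphere.
\<close>

lemma is_norm_dominates_norm:
  fixes N :: "'a::euclidean_space \<Rightarrow> real"
  assumes "is_norm N"
  obtains m where "0 < m" "\<And>z. m * norm z \<le> N z"
proof -
  have "continuous_on UNIV N"
    by (rule convex_on_continuous[OF open_UNIV is_norm_convex_on[OF assms]])
  then have cont: "continuous_on (sphere 0 1) N"
    by (rule continuous_on_subset) simp
  obtain e :: 'a where e: "e \<in> sphere 0 1" "\<And>z. z \<in> sphere 0 1 \<Longrightarrow> N e \<le> N z"
    using continuous_attains_inf[OF compact_sphere _ cont] by fastforce
  have "N e * norm z \<le> N z" for z
  proof (cases "z = 0")
    case True
    then show ?thesis using is_norm_zero[OF assms] by simp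
  next
    case False
    then have "N e \<le> N (inverse (norm z) *\<^sub>R z)"
      by (intro e(2)) simp
    then show ?thesis
      using False by (simp add: is_norm_scaleR[OF assms] field_simps)
  qed
  moreover have "e \<noteq> 0"
    using e(1) by auto
  ultimately show thesis
    using is_norm_pos[OF assms] that by blast
qed

lemma bdd_above_dual_norm:
  fixes y :: "'a::euclidean_space"
  assumes "is_norm N"
  shows "bdd_above ((\<lambda>x. x \<bullet> y) ` {x. N x \<le> 1})"
proof -
  obtain m where m: "0 < m" "\<And>z. m * norm z \<le> N z"
    using is_norm_dominates_norm[OF assms] by blast
  have "x \<bullet> y \<le> 1 / m * norm y" if "N x \<le> 1" for x
  proof -
    have "norm x \<le> 1 / m"
      using m(2)[of x] that m(1) by (simp add: field_simps)
    then show ?thesis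
      using norm_cauchy_schwarz[of x y] by (meson mult_right_mono norm_ge_zero order_trans)
  qed
  then show ?thesis by (auto simp: bdd_above_def)
qed

lemma dual_norm_nonneg:
  assumes "is_norm N"
  shows "0 \<le> dual_norm N y"
  unfolding dual_norm_def
  by (rule cSUP_upper2[where x = 0])
     (use bdd_above_dual_norm[OF assms] is_norm_zero[OF assms] in auto)

lemma dual_norm_zero:
  assumes "is_norm N"
  shows "dual_norm N 0 = 0"
proof -
  have "{x. N x \<le> 1} \<noteq> {}"
    using is_norm_zero[OF assms] by (metis empty_Collect_eq zero_le_one)
  then show ?thesis by (simp add: dual_norm_def)
qed

lemma capra_le_dual_norm:
  assumes "is_norm N"
  shows "capra N x y \<le> dual_norm N y"
proof (cases "x = 0")
  case True
  then show ?thesis using dual_norm_nonneg[OF assms] by (simp add: capra_def)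
next
  case False
  then have pos: "0 < N x" by (rule is_norm_pos[OF assms])
  have "(inverse (N x) *\<^sub>R x) \<bullet> y \<le> dual_norm N y"
    unfolding dual_norm_def
    using pos by (intro cSUP_upper bdd_above_dual_norm[OF assms])
      (simp add: is_norm_scaleR[OF assms])
  then show ?thesis using False by (simp add: capra_def field_simps)
qed

lemma inner_le_dual_norm:
  assumes "is_norm N"
  shows "x \<bullet> y \<le> N x * dual_norm N y"
proof (cases "x = 0")
  case False
  then show ?thesis
    using capra_le_dual_norm[OF assms, of x y] is_norm_pos[OF assms False]
    by (simp add: capra_def field_simps)
qed (simp add: is_norm_zero[OF assms])

lemma capra_scaleR_right: "capra N x (t *\<^sub>R y) = t * capra N x y"
  by (simp add: capra_def)

text \<open>
  This is the Hahn-Banach theorem in finite dimension: \<open>y\<close> is the normal of a hyperplane separating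
  \<open>x\<close> from the open ball of radius \<open>N x\<close>.
\<close>

lemma ex_dual_vector:
  fixes N :: "real ^ 'n \<Rightarrow> real"
  assumes N: "is_norm N" and x: "x \<noteq> 0"
  obtains y where "y \<noteq> 0" "x \<bullet> y = N x * dual_norm N y"
proof -
  have pos: "0 < N x" by (rule is_norm_pos[OF N x])
  define B where "B = {z. N z < N x}"
  have "convex B"
    unfolding B_def
  proof (rule convexI, clarify)
    fix u v and a b :: real
    assume ab: "0 \<le> a" "0 \<le> b" "a + b = 1" and uv: "N u < N x" "N v < N x"
    have "N (a *\<^sub>R u + b *\<^sub>R v) \<le> N (a *\<^sub>R u) + N (b *\<^sub>R v)"
      using N unfolding is_norm_def by blast
    also have "\<dots> = a * N u + b * N v"
      using ab by (simp add: is_norm_scaleR[OF N])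
    also have "\<dots> < N x"
      by (rule convex_bound_lt[OF uv ab])
    finally show "N (a *\<^sub>R u + b *\<^sub>R v) < N x" .
  qed
  moreover have "0 \<in> B" using pos by (simp add: B_def is_norm_zero[OF N])
  moreover have "B \<inter> {x} = {}" by (simp add: B_def)
  ultimately obtain y b where y: "y \<noteq> 0" "\<forall>z\<in>B. y \<bullet> z \<le> b" "\<forall>z\<in>{x}. y \<bullet> z \<ge> b"
    using separating_hyperplane_sets[of B "{x}"] by blast
  have sep: "z \<bullet> y \<le> x \<bullet> y" if "N z < N x" for z
    using y(2,3) that by (force simp: B_def inner_commute)
  have ball: "z \<bullet> y \<le> x \<bullet> y / N x" if "N z \<le> 1" for z
  proof (rule field_le_mult_one_interval)
    \<comment> \<open>Points of the closed ball are first shrunk into the open one.\<close>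
    fix s :: real assume s: "0 < s" "s < 1"
    have "s * N z < 1"
      using s that by (smt (verit) mult_left_le)
    then have "(s * N x) * N z < N x"
      using pos by (simp add: field_simps)
    then have "N ((s * N x) *\<^sub>R z) < N x"
      using s pos by (simp add: is_norm_scaleR[OF N])
    from sep[OF this] show "s * (z \<bullet> y) \<le> x \<bullet> y / N x"
      using pos by (simp add: field_simps)
  qed
  have "dual_norm N y \<le> x \<bullet> y / N x"
    unfolding dual_norm_def
    using ball is_norm_zero[OF N] by (intro cSUP_least) (auto intro!: exI[of _ 0])
  then have "N x * dual_norm N y \<le> x \<bullet> y"
    using pos by (simp add: field_simps)
  then show thesis
    using that[OF y(1)] inner_le_dual_norm[OF N, of x y] by simp
qed

section \<open>Restriction to a set of coordinates\<close>

definition restrict_coords :: "'n set \<Rightarrow> real ^ 'n \<Rightarrow> real ^ 'n" where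
  "restrict_coords K y = (\<chi> i. if i \<in> K then y $ i else 0)"

lemma inner_restrict_coords_right:
  assumes "supp x \<inter> supp y \<subseteq> K"
  shows "x \<bullet> restrict_coords K y = x \<bullet> y"
  unfolding inner_vec_def restrict_coords_def
  using assms by (intro sum.cong) (auto simp: supp_def)

lemma restrict_coords_eq:
  assumes "supp y \<subseteq> K"
  shows "restrict_coords K y = y"
  using assms by (auto simp: vec_eq_iff restrict_coords_def supp_def)

lemma orthant_strictly_monotonic_restrict_coords:
  assumes "orthant_strictly_monotonic N" "\<not> supp y \<subseteq> K"
  shows "N (restrict_coords K y) < N y"
proof -
  obtain j where "y $ j \<noteq> 0" "j \<notin> K"
    using assms(2) by (auto simp: supp_def)
  then have "\<exists>i. \<bar>restrict_coords K y $ i\<bar> < \<bar>y $ i\<bar>"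
    by (auto simp: restrict_coords_def intro!: exI[of _ j])
  then show ?thesis
    using assms(1) unfolding orthant_strictly_monotonic_def
    by (auto simp: restrict_coords_def)
qed

text \<open>
  Since \<open>x \<bullet> y\<close> depends only on the coordinates of \<open>y\<close> in \<open>supp x\<close>, only the restriction of \<open>y\<close> to
  \<open>supp x\<close> matters for the coupling.
\<close>

lemma capra_le_dual_norm_restrict_coords:
  assumes "is_norm N"
  shows "capra N x y \<le> dual_norm N (restrict_coords (supp x) y)"
proof -
  have "x \<bullet> restrict_coords (supp x) y = x \<bullet> y"
    by (rule inner_restrict_coords_right) blast
  then have "capra N x y = capra N x (restrict_coords (supp x) y)"
    by (simp add: capra_def)
  then show ?thesis
    using capra_le_dual_norm[OF assms] by simp
qed

text \<open>
  Each inclusion between the supports comes from one of the two norms: a coordinate carried by only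
  one of \<open>x\<close> and \<open>y\<close> could be erased without changing \<open>x \<bullet> y\<close>, which would contradict
  the inequality \<open>x \<bullet> y \<le> N x * dual_norm N y\<close> for the shortened vector.
\<close>

lemma ex_dual_vector_same_supp:
  fixes N :: "real ^ 'n \<Rightarrow> real"
  assumes N: "is_norm N"
    and mono_N: "orthant_strictly_monotonic N"
    and mono_dual: "orthant_strictly_monotonic (dual_norm N)"
  obtains y where "supp y = supp x" "capra N x y = dual_norm N y"
proof (cases "x = 0")
  case True
  then show thesis
    using that[of 0] by (simp add: capra_def dual_norm_zero[OF N])
next
  case False
  have pos: "0 < N x" by (rule is_norm_pos[OF N False])
  obtain y where y: "y \<noteq> 0" "x \<bullet> y = N x * dual_norm N y"
    using ex_dual_vector[OF N False] .
  have yx: "supp y \<subseteq> supp x"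
  proof (rule ccontr)
    assume "\<not> supp y \<subseteq> supp x"
    then have "dual_norm N (restrict_coords (supp x) y) < dual_norm N y"
      by (rule orthant_strictly_monotonic_restrict_coords[OF mono_dual])
    then have "N x * dual_norm N (restrict_coords (supp x) y) < x \<bullet> y"
      using pos y(2) by simp
    moreover have "x \<bullet> restrict_coords (supp x) y = x \<bullet> y"
      by (rule inner_restrict_coords_right) blast
    ultimately show False
      using inner_le_dual_norm[OF N, of x "restrict_coords (supp x) y"] by linarith
  qed
  \<comment> \<open>Comparing \<open>y\<close> with its restriction to no coordinate at all shows that its dual norm is positive.\<close>
  have "\<not> supp y \<subseteq> {}"
    using y(1) by (auto simp: supp_def vec_eq_iff)
  then have "0 < dual_norm N y"
    using orthant_strictly_monotonic_restrict_coords[OF mono_dual, of y "{}"]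
      dual_norm_nonneg[OF N] by (meson order_le_less_trans)
  have "supp x \<subseteq> supp y"
  proof (rule ccontr)
    assume "\<not> supp x \<subseteq> supp y"
    then have "N (restrict_coords (supp y) x) < N x"
      by (rule orthant_strictly_monotonic_restrict_coords[OF mono_N])
    then have "N (restrict_coords (supp y) x) * dual_norm N y < x \<bullet> y"
      using \<open>0 < dual_norm N y\<close> y(2) by simp
    moreover have "restrict_coords (supp y) x \<bullet> y = x \<bullet> y"
      using inner_restrict_coords_right[of y x "supp y"] by (simp add: inner_commute)
    ultimately show False
      using inner_le_dual_norm[OF N, of "restrict_coords (supp y) x" y] by linarith
  qed
  moreover have "capra N x y = dual_norm N y"
    using y(2) pos False by (simp add: capra_def)
  ultimately show thesis
    using that yx by blast
qed

section \<open>Capra-convexity of nondecreasing functions of the support\<close>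

text \<open>
  A dual vector \<open>y\<close> with the same support as \<open>x\<close> controls every \<open>z\<close> whose support contains
  \<open>supp x\<close>. For the other \<open>z\<close>, passing from \<open>x\<close> to \<open>z\<close> may decrease \<open>F\<close>, and scaling \<open>y\<close> up
  compensates for this, because the coupling then drops by at least \<open>t * gap (supp z)\<close> with a
  positive gap.
\<close>

lemma ex_capra_subgradient:
  fixes N :: "real ^ 'n \<Rightarrow> real" and F :: "'n set \<Rightarrow> real"
  assumes N: "is_norm N"
    and mono_N: "orthant_strictly_monotonic N"
    and mono_dual: "orthant_strictly_monotonic (dual_norm N)"
    and F: "mono F"
  obtains y where "\<And>z. capra N z y - F (supp z) \<le> capra N x y - F (supp x)"
proof -
  obtain y where y: "supp y = supp x" "capra N x y = dual_norm N y"
    using ex_dual_vector_same_supp[OF N mono_N mono_dual] .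
  define gap where "gap K = dual_norm N y - dual_norm N (restrict_coords K y)" for K
  \<comment> \<open>There are finitely many sets \<open>K\<close>, so a scaling factor that works for all of them exists once
    all large enough factors work for each of them.\<close>
  have "\<forall>\<^sub>F t in at_top. \<not> supp x \<subseteq> K \<longrightarrow> F (supp x) - F {} \<le> t * gap K" for K
  proof (cases "supp x \<subseteq> K")
    case False
    then have "0 < gap K"
      using orthant_strictly_monotonic_restrict_coords[OF mono_dual, of y K] y(1)
      by (simp add: gap_def)
    then show ?thesis
      using eventually_ge_at_top[of "(F (supp x) - F {}) / gap K"]
      by (auto elim!: eventually_mono simp: field_simps)
  qed simp
  then have "\<forall>\<^sub>F t in at_top. \<forall>K. \<not> supp x \<subseteq> K \<longrightarrow> F (supp x) - F {} \<le> t * gap K"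
    by (rule eventually_all_finite)
  then have "\<forall>\<^sub>F t in at_top. 0 \<le> t \<and> (\<forall>K. \<not> supp x \<subseteq> K \<longrightarrow> F (supp x) - F {} \<le> t * gap K)"
    using eventually_ge_at_top[of 0] by eventually_elim blast
  then obtain t where t: "0 \<le> t"
    "\<And>K. \<not> supp x \<subseteq> K \<Longrightarrow> F (supp x) - F {} \<le> t * gap K"
    using eventually_happens'[OF trivial_limit_at_top_linorder] by blast
  have "capra N z (t *\<^sub>R y) - F (supp z) \<le> capra N x (t *\<^sub>R y) - F (supp x)" for z
  proof -
    have "t * capra N z y \<le> t * dual_norm N (restrict_coords (supp z) y)"
      by (rule mult_left_mono[OF capra_le_dual_norm_restrict_coords[OF N] t(1)])
    then have le: "t * capra N z y \<le> t * capra N x y - t * gap (supp z)"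
      by (simp add: gap_def y(2) algebra_simps)
    have "F (supp x) - F (supp z) \<le> t * gap (supp z)"
    proof (cases "supp x \<subseteq> supp z")
      case True
      then have "gap (supp z) = 0"
        using y(1) by (simp add: gap_def restrict_coords_eq)
      then show ?thesis
        using monoD[OF F True] by simp
    next
      case False
      have "F {} \<le> F (supp z)"
        by (rule monoD[OF F]) simp
      then show ?thesis
        using t(2)[OF False] by linarith
    qed
    then show ?thesis
      using le by (simp add: capra_scaleR_right)
  qed
  then show thesis by (rule that)
qed

theorem theorem6:
  fixes N :: "real ^ 'n \<Rightarrow> real" and F :: "'n set \<Rightarrow> real"
  assumes "is_norm N"
    and "orthant_strictly_monotonic N"
    and "orthant_strictly_monotonic (dual_norm N)"
    and "mono F"
  shows "biconjugate (capra N) (\<lambda>x. ereal (F (supp x))) = (\<lambda>x. ereal (F (supp x)))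
       \<and> coupling_convex (capra N) (\<lambda>x. ereal (F (supp x)))"
proof -
  have "biconjugate (capra N) (\<lambda>x. ereal (F (supp x))) x = ereal (F (supp x))" for x
  proof -
    obtain y where "\<And>z. capra N z y - F (supp z) \<le> capra N x y - F (supp x)"
      using ex_capra_subgradient[OF assms, of x] by blast
    then show ?thesis by (rule biconjugate_eq_if_subgradient)
  qed
  then have "biconjugate (capra N) (\<lambda>x. ereal (F (supp x))) = (\<lambda>x. ereal (F (supp x)))"
    by (rule ext)
  then show ?thesis
    by (simp add: coupling_convex_def)
qed

end
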